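(* Fix $n\ge2$ and $1\le r\le n-1$. As $\kappa\to\infty$, $$p_{n,r}(\kappa)\sim\binom nr\frac{(n-r)^{n-r+1}}{r^{n-r}}\,\kappa^{-(n-r)}.$$ Consequently, as $\kappa\to\infty$, $$\underline p_n(\kappa)\sim n(n-1)^n\kappa^{-(n-1)}.$$
   Context: For integers $1\le r\le n-1$ and $\kappa\ge1$ let $$P_{n,r,\kappa}(z):=(1-z)^r\Bigl(1+\frac{\kappa r}{n-r}z\Bigr)^{n-r},\qquad 0\le z\le1.$$ If $\kappa>1$, $p_{n,r}(\kappa)\in(0,1)$ denotes the unique solution $p\in(0,1)$ of $\int_0^1z^{-p}P'_{n,r,\kappa}(z)\,dz=0$. For $\kappa=1$, $p_{n,r}(1):=1$. Put $\underline p_n(\kappa):=\min_{1\le r\le n-1}p_{n,r}(\kappa)$. The notation $f\sim g$ means $f/g\to1$. *)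

theory Defs
  imports "HOL-Analysis.Analysis" "HOL-Library.Landau_Symbols"
begin

definition P_poly :: "nat \<Rightarrow> nat \<Rightarrow> real \<Rightarrow> real \<Rightarrow> real" where
  "P_poly n r \<kappa> z = (1 - z) ^ r * (1 + \<kappa> * real r / real (n - r) * z) ^ (n - r)"

text \<open>
  For \<open>p < 1\<close> the integrand below is Lebesgue integrable on \<open>{0..1}\<close>, so the integral never
  falls back on the default value; \<open>0 powr (-p) = 0\<close> only affects a null set.
  The parameter range of interest is \<open>1 \<le> r \<le> n - 1\<close> and \<open>\<kappa> \<ge> 1\<close>.
\<close>
definition p_crit :: "nat \<Rightarrow> nat \<Rightarrow> real \<Rightarrow> real" where
  "p_crit n r \<kappa> =
    (if \<kappa> = 1 then 1
     else (THE p. 0 < p \<and> p < 1 \<and>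
             (LBINT z:{0..1}. z powr (- p) * deriv (P_poly n r \<kappa>) z) = 0))"

definition p_low :: "nat \<Rightarrow> real \<Rightarrow> real" where
  "p_low n \<kappa> = Min ((\<lambda>r. p_crit n r \<kappa>) ` {1..n - 1})"

end

theory Submission
  imports Defs
begin

text \<open>
  Write \<open>m = n - r\<close> and let \<open>c\<^sub>k\<close> be the coefficients of the polynomial \<open>P\<close>. Since
  \<open>P(0) = 1\<close> and \<open>P(1) = 0\<close>, integrating term by term turns the defining equation of the
  critical exponent into a rational one: for \<open>p < 1\<close>,
  \<open>\<integral>\<^sub>0\<^sup>1 z powr (- p) * P'(z) dz = p * (\<Sum>k=1..n. c\<^sub>k / (k - p)) - 1\<close>
  (lemma \<open>crit_integral_eq\<close>).

  The coefficients grow at most like \<open>\<kappa> ^ m\<close>, and \<open>P / \<kappa> ^ m\<close> tends coefficientwise to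
  \<open>(r / m) ^ m * z ^ m * (1 - z) ^ r\<close>. Substituting \<open>p = t / \<kappa> ^ m\<close> with \<open>t\<close> fixed
  therefore gives \<open>t / L - 1\<close> in the limit, where \<open>1 / L\<close> is
  \<open>(r / m) ^ m\<close> times the Beta integral of \<open>z ^ (m - 1) * (1 - z) ^ r\<close>; evaluating it gives
  \<open>L = crit_const n r\<close> (lemma \<open>rescaled_crit_integral_tendsto\<close>). So for \<open>s < L < t\<close> and large
  \<open>\<kappa>\<close> the integral changes sign between \<open>s / \<kappa> ^ m\<close> and \<open>t / \<kappa> ^ m\<close>, and it vanishes
  somewhere in between. This zero is the critical exponent because there is no other one:
  \<open>P'\<close> changes sign exactly once on \<open>(0, 1)\<close>, which makes the integral, after a positive
  rescaling depending on \<open>p\<close>, strictly increasing in \<open>p\<close>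
  (lemma \<open>powr_moment_zero_unique\<close>). Letting \<open>s\<close> and \<open>t\<close> approach \<open>L\<close> gives
  \<open>p_crit n r \<kappa> * \<kappa> ^ m \<longlongrightarrow> L\<close>.

  The decay is fastest for the largest \<open>m\<close>, that is for \<open>r = 1\<close>, so \<open>r = 1\<close> realises the
  minimum as soon as \<open>\<kappa>\<close> is large.
\<close>

section \<open>Moments of polynomials against a negative power\<close>

lemma powr_integral_unit_interval:
  fixes s :: real
  assumes "s > -1"
  shows "set_integrable lborel {0..1} (\<lambda>z. z powr s)"
    and "(LBINT z:{0..1}. z powr s) = 1 / (s + 1)"
proof -
  have hi: "((\<lambda>z. z powr s) has_integral (1 / (s + 1))) {0..1}"
    using has_integral_powr_from_0[OF assms, of 1] by simp
  then have "(\<lambda>z. z powr s) absolutely_integrable_on {0..1}"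
    by (intro nonnegative_absolutely_integrable_1) auto
  then show si: "set_integrable lborel {0..1} (\<lambda>z. z powr s)"
    unfolding set_integrable_def by (subst (asm) integrable_completion) auto
  show "(LBINT z:{0..1}. z powr s) = 1 / (s + 1)"
    using set_borel_integral_eq_integral(2)[OF si] hi by (simp add: integral_unique)
qed

text \<open>
  Both claims are termwise consequences of the monomial case; the hypothesis \<open>p < 1\<close> makes even
  the constant term integrable at \<open>0\<close>.
\<close>

lemma powr_moment_poly:
  fixes p :: real and q :: "real poly"
  assumes "p < 1"
  shows "set_integrable lborel {0..1} (\<lambda>z. z powr (- p) * poly q z)"
    and "(LBINT z:{0..1}. z powr (- p) * poly q z)
           = (\<Sum>i\<le>degree q. coeff q i / (real i + 1 - p))"
proof -
  have eq: "z powr (- p) * poly q z = (\<Sum>i\<le>degree q. coeff q i * z powr (real i - p))"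
    if "z \<in> {0..1}" for z
    using that
    by (cases "z = 0")
      (auto simp: poly_altdef sum_distrib_left powr_diff powr_minus powr_realpow field_simps
        intro!: sum.cong)
  have int: "set_integrable lborel {0..1} (\<lambda>z. coeff q i * z powr (real i - p))" for i
    using powr_integral_unit_interval(1)[of "real i - p"] assms by simp
  have "set_integrable lborel {0..1} (\<lambda>z. \<Sum>i\<le>degree q. coeff q i * z powr (real i - p))"
    using int unfolding set_integrable_def scaleR_sum_right
    by (intro Bochner_Integration.integrable_sum)
  then show "set_integrable lborel {0..1} (\<lambda>z. z powr (- p) * poly q z)"
    by (rule iffD1[OF set_integrable_cong, rotated -1]) (use eq in auto)
  have "(LBINT z:{0..1}. z powr (- p) * poly q z)
      = (LBINT z:{0..1}. \<Sum>i\<le>degree q. coeff q i * z powr (real i - p))"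
    by (rule set_lebesgue_integral_cong) (use eq in auto)
  also have "\<dots> = (\<Sum>i\<le>degree q. LBINT z:{0..1}. coeff q i * z powr (real i - p))"
    using int unfolding set_lebesgue_integral_def set_integrable_def scaleR_sum_right
    by (intro Bochner_Integration.integral_sum)
  also have "\<dots> = (\<Sum>i\<le>degree q. coeff q i / (real i + 1 - p))"
    using powr_integral_unit_interval(2)[of "real i - p" for i] assms
    by (intro sum.cong) (auto simp: algebra_simps)
  finally show "(LBINT z:{0..1}. z powr (- p) * poly q z)
           = (\<Sum>i\<le>degree q. coeff q i / (real i + 1 - p))" .
qed

text \<open>
  For \<open>p < 1\<close> and \<open>degree Q \<le> N\<close> this is the integral
  \<open>\<integral>\<^sub>0\<^sup>1 z powr (- p - 1) * (Q(z) - Q(0)) dz\<close>. The cutoff \<open>N\<close> is a parameter, rather than the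
  degree of \<open>Q\<close>, so that \<open>pole_sum N\<close> is linear in \<open>Q\<close> and limits in the coefficients of \<open>Q\<close>
  pass through it.
\<close>

definition pole_sum :: "nat \<Rightarrow> real poly \<Rightarrow> real \<Rightarrow> real" where
  "pole_sum N Q p = (\<Sum>k=1..N. coeff Q k / (real k - p))"

text \<open>
  From \<open>k / (k - p) = 1 + p / (k - p)\<close>: the ones sum to \<open>Q(1) - Q(0)\<close> and the rest carries a
  factor \<open>p\<close>. This is integration by parts for \<open>Q - Q(0)\<close>, whose boundary term at \<open>0\<close> vanishes.
\<close>

lemma powr_moment_pderiv:
  fixes p :: real and Q :: "real poly"
  assumes p: "p < 1" and deg: "degree Q \<le> N"
  shows "(LBINT z:{0..1}. z powr (- p) * poly (pderiv Q) z)
           = poly Q 1 - poly Q 0 + p * pole_sum N Q p"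
proof -
  have "(LBINT z:{0..1}. z powr (- p) * poly (pderiv Q) z)
      = (\<Sum>i\<le>degree (pderiv Q). coeff (pderiv Q) i / (real i + 1 - p))"
    using powr_moment_poly(2)[OF p] .
  also have "\<dots> = (\<Sum>i\<le>N. coeff (pderiv Q) i / (real i + 1 - p))"
    using deg degree_pderiv[of Q]
    by (intro sum.mono_neutral_left) (auto simp: coeff_eq_0)
  also have "\<dots> = (\<Sum>i<N. coeff (pderiv Q) i / (real i + 1 - p))"
    using deg by (intro sum.mono_neutral_right) (auto simp: coeff_pderiv coeff_eq_0)
  also have "\<dots> = (\<Sum>i<N. coeff Q (Suc i) + p * (coeff Q (Suc i) / (real (Suc i) - p)))"
  proof (rule sum.cong[OF refl])
    fix i
    have "real i + 1 - p \<noteq> 0" using p by linarith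
    then show "coeff (pderiv Q) i / (real i + 1 - p)
        = coeff Q (Suc i) + p * (coeff Q (Suc i) / (real (Suc i) - p))"
      by (simp add: coeff_pderiv divide_simps) (simp add: algebra_simps)
  qed
  also have "\<dots> = (\<Sum>k=1..N. coeff Q k) + p * pole_sum N Q p"
    by (simp add: pole_sum_def sum.distrib sum_distrib_left sum.atLeast1_atMost_eq)
  also have "(\<Sum>k=1..N. coeff Q k) = poly Q 1 - poly Q 0"
  proof -
    have "poly Q 1 = (\<Sum>k\<le>N. coeff Q k)"
      using deg by (simp add: poly_altdef coeff_eq_0 sum.mono_neutral_left)
    also have "\<dots> = coeff Q 0 + (\<Sum>k=1..N. coeff Q k)"
      by (simp add: atMost_atLeast0 sum.atLeast_Suc_atMost)
    finally show ?thesis by (simp add: poly_0_coeff_0)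
  qed
  finally show ?thesis .
qed

text \<open>
  Multiplying the moment of exponent \<open>s\<close> by \<open>c powr s\<close> replaces the weight by
  \<open>(z / c) powr (- s)\<close>. As \<open>s\<close> grows, this weight increases on the left of \<open>c\<close>, where \<open>f\<close> is
  positive, and decreases on the right of \<open>c\<close>, where \<open>f\<close> is negative. So the normalised moment is
  strictly increasing in \<open>s\<close> and cannot vanish twice.
\<close>

lemma powr_moment_zero_unique:
  fixes f :: "real \<Rightarrow> real" and c p q :: real
  assumes c: "0 < c" "c < 1"
    and pos: "\<And>z. 0 < z \<Longrightarrow> z < c \<Longrightarrow> f z > 0"
    and neg: "\<And>z. c < z \<Longrightarrow> z < 1 \<Longrightarrow> f z < 0"
    and int: "set_integrable lborel {0..1} (\<lambda>z. z powr (- p) * f z)"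
      "set_integrable lborel {0..1} (\<lambda>z. z powr (- q) * f z)"
    and pq: "p < q"
    and zero: "(LBINT z:{0..1}. z powr (- p) * f z) = 0"
      "(LBINT z:{0..1}. z powr (- q) * f z) = 0"
  shows False
proof -
  \<comment> \<open>The normalised integrand \<open>(z / c) powr (- s) * f z\<close>, cut off outside the unit interval.\<close>
  define F where "F s z = indicator {0..1} z *\<^sub>R (c powr s * (z powr (- s) * f z))" for s z
  have F_eq: "F s z = (z / c) powr (- s) * f z" if "0 < z" "z < 1" for s z
    using that c by (simp add: F_def powr_divide powr_minus field_simps)
  have intF: "integrable lborel (F p)" "integrable lborel (F q)"
    using set_integrable_mult_right[OF int(1), of "c powr p"]
      set_integrable_mult_right[OF int(2), of "c powr q"]
    unfolding F_def[abs_def] set_integrable_def by auto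
  have zeroF: "integral\<^sup>L lborel (F p) = 0" "integral\<^sup>L lborel (F q) = 0"
    using zero set_integral_mult_right[of lborel "{0..1}" "c powr p" "\<lambda>z. z powr (- p) * f z"]
      set_integral_mult_right[of lborel "{0..1}" "c powr q" "\<lambda>z. z powr (- q) * f z"]
    unfolding F_def[abs_def] set_lebesgue_integral_def by auto
  have less: "F p z < F q z" if z: "0 < z" "z < c" for z
  proof -
    have "(z / c) powr (- p) < (z / c) powr (- q)"
      using z c pq powr_less_mono'[of "z / c" "- q" "- p"] by simp
    then show ?thesis
      using z c pos[OF z] by (simp add: F_eq)
  qed
  have le: "F p z \<le> F q z" if z: "z \<noteq> 0" "z \<noteq> c" "z \<noteq> 1" for z
  proof (cases "0 < z \<and> z < 1")
    case True
    show ?thesis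
    proof (cases "z < c")
      case False
      then have "(z / c) powr (- p) > (z / c) powr (- q)"
        using True z c pq by (intro powr_less_mono) auto
      then show ?thesis
        using True False z neg[of z] by (simp add: F_eq mult_right_mono_neg)
    qed (use less True in \<open>auto intro: less_imp_le\<close>)
  qed (use z in \<open>auto simp: F_def indicator_def\<close>)
  have "AE z in lborel. F q z - F p z = 0"
  proof (subst integral_nonneg_eq_0_iff_AE[symmetric])
    show "AE z in lborel. 0 \<le> F q z - F p z"
      using AE_lborel_singleton[of 0] AE_lborel_singleton[of c] AE_lborel_singleton[of 1]
      by eventually_elim (use le in auto)
  qed (use intF zeroF in auto)
  then have "AE z in lborel. z \<notin> {0<..<c}"
    by eventually_elim (use less in force)
  then have "{0<..<c} \<in> null_sets lborel"
    by (subst AE_iff_null_sets) auto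
  then have "emeasure lborel {0<..<c} = 0" by (rule null_setsD1)
  then show False using c by simp
qed

section \<open>The critical exponent as the only zero of the integral\<close>

definition crit_poly :: "nat \<Rightarrow> nat \<Rightarrow> real \<Rightarrow> real poly" where
  "crit_poly n r \<kappa> = [:1, -1:] ^ r * [:1, \<kappa> * real r / real (n - r):] ^ (n - r)"

lemma P_poly_eq_poly: "P_poly n r \<kappa> = poly (crit_poly n r \<kappa>)"
  by (rule ext) (simp add: P_poly_def crit_poly_def poly_power mult.commute)

lemma degree_crit_poly: "r \<le> n \<Longrightarrow> degree (crit_poly n r \<kappa>) \<le> n"
proof -
  assume "r \<le> n"
  have "degree ([:1, -1 :: real:] ^ r) \<le> r"
    using degree_power_le[of "[:1, -1 :: real:]" r] by simp
  moreover have "degree ([:1, \<kappa> * real r / real (n - r):] ^ (n - r)) \<le> n - r"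
    using degree_power_le[of "[:1, \<kappa> * real r / real (n - r):]" "n - r"]
    by (auto split: if_splits)
  ultimately show ?thesis
    unfolding crit_poly_def using \<open>r \<le> n\<close>
    by (intro order.trans[OF degree_mult_le]) linarith
qed

lemma poly_pderiv_linear_power:
  "poly (pderiv ([:a, b :: real:] ^ Suc k)) z = real (Suc k) * b * (a + b * z) ^ k"
  by (simp add: pderiv_power_Suc pderiv_pCons poly_power mult.commute del: of_nat_Suc power_Suc)

text \<open>
  The factored form exhibits the sign of the derivative on \<open>(0, 1)\<close>: for \<open>\<kappa> \<ge> 0\<close> only the last,
  affine factor can change sign there.
\<close>

lemma poly_pderiv_crit_poly:
  assumes "1 \<le> r" "r < n"
  shows "poly (pderiv (crit_poly n r \<kappa>)) z
    = real r * (1 - z) ^ (r - 1) * (1 + \<kappa> * real r / real (n - r) * z) ^ (n - r - 1)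
        * (\<kappa> - 1 - \<kappa> * real n / real (n - r) * z)"
proof -
  obtain s where s: "r = Suc s" using assms by (cases r) auto
  obtain m where m: "n - r = Suc m" using assms by (cases "n - r") auto
  have n: "real n = real (Suc m) + real (Suc s)" using assms m s by simp
  define c where "c = \<kappa> * real (Suc s) / real (Suc m)"
  define A where "A = (1 - z) ^ s"
  define B where "B = (1 + c * z) ^ m"
  have "poly (pderiv ([:1, -1:] ^ Suc s * [:1, c:] ^ Suc m)) z
      = (1 - z) * A * (real (Suc m) * c * B) + (1 + c * z) * B * (real (Suc s) * (- 1) * A)"
    unfolding pderiv_mult poly_add poly_mult poly_pderiv_linear_power
    by (simp add: A_def B_def poly_power algebra_simps del: of_nat_Suc)
  also have "\<dots> = A * B * (real (Suc m) * c * (1 - z) - real (Suc s) * (1 + c * z))"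
    by (simp add: algebra_simps del: of_nat_Suc)
  also have "real (Suc m) * c * (1 - z) - real (Suc s) * (1 + c * z)
      = real (Suc s) * (\<kappa> - 1 - \<kappa> * real n / real (Suc m) * z)"
    unfolding c_def n by (simp add: field_simps del: of_nat_Suc)
  finally show ?thesis
    unfolding crit_poly_def m unfolding s
    by (simp add: A_def B_def c_def del: of_nat_Suc power_Suc)
qed

definition crit_integral :: "nat \<Rightarrow> nat \<Rightarrow> real \<Rightarrow> real \<Rightarrow> real" where
  "crit_integral n r \<kappa> p = (LBINT z:{0..1}. z powr (- p) * deriv (P_poly n r \<kappa>) z)"

lemma deriv_P_poly: "deriv (P_poly n r \<kappa>) = poly (pderiv (crit_poly n r \<kappa>))"
  unfolding P_poly_eq_poly by (rule ext) (rule DERIV_imp_deriv, rule poly_DERIV)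

lemma crit_integral_eq:
  assumes "1 \<le> r" "r < n" "p < 1"
  shows "crit_integral n r \<kappa> p = p * pole_sum n (crit_poly n r \<kappa>) p - 1"
proof -
  have "poly (crit_poly n r \<kappa>) 1 = 0" "poly (crit_poly n r \<kappa>) 0 = 1"
    using assms by (simp_all add: crit_poly_def poly_power)
  then show ?thesis
    using powr_moment_pderiv[OF assms(3) degree_crit_poly[of r n \<kappa>]] assms
    by (simp add: crit_integral_def deriv_P_poly)
qed

text \<open>
  For \<open>\<kappa> > 1\<close> the zero of the affine factor of the derivative lies strictly inside \<open>(0, 1)\<close>, which
  is the single sign change needed for the uniqueness of the zero.
\<close>

lemma crit_integral_zero_unique:
  assumes r: "1 \<le> r" "r < n" and \<kappa>: "\<kappa> > 1" and pq: "p < 1" "q < 1"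
    and zero: "crit_integral n r \<kappa> p = 0" "crit_integral n r \<kappa> q = 0"
  shows "p = q"
proof -
  define f where "f = poly (pderiv (crit_poly n r \<kappa>))"
  define c where "c = real (n - r) * (\<kappa> - 1) / (\<kappa> * real n)"
  have c: "0 < c" using r \<kappa> by (simp add: c_def)
  have "real (n - r) * (\<kappa> - 1) < \<kappa> * real n"
    using r \<kappa> mult_strict_mono[of "real (n - r)" "real n" "\<kappa> - 1" \<kappa>] by (simp add: mult.commute)
  then have c1: "c < 1" using r \<kappa> by (simp add: c_def)
  have lin: "\<kappa> - 1 - \<kappa> * real n / real (n - r) * z = \<kappa> * real n / real (n - r) * (c - z)" for z
    using r \<kappa> by (simp add: c_def field_simps)
  have f: "f z = (real r * (1 - z) ^ (r - 1) * (1 + \<kappa> * real r / real (n - r) * z) ^ (n - r - 1)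
        * (\<kappa> * real n / real (n - r))) * (c - z)" for z
    unfolding f_def poly_pderiv_crit_poly[OF r] lin by simp
  have factor: "real r * (1 - z) ^ (r - 1) * (1 + \<kappa> * real r / real (n - r) * z) ^ (n - r - 1)
        * (\<kappa> * real n / real (n - r)) > 0" if "0 < z" "z < 1" for z
    using that r \<kappa> by (intro mult_pos_pos zero_less_power add_pos_pos divide_pos_pos) auto
  have pos: "f z > 0" if "0 < z" "z < c" for z
    unfolding f using that c1 by (intro mult_pos_pos factor) auto
  have neg: "f z < 0" if "c < z" "z < 1" for z
    unfolding f using that c by (intro mult_pos_neg factor) auto
  have int: "set_integrable lborel {0..1} (\<lambda>z. z powr (- s) * f z)" if "s < 1" for s
    unfolding f_def using that by (rule powr_moment_poly(1))
  have zero': "(LBINT z:{0..1}. z powr (- p) * f z) = 0" "(LBINT z:{0..1}. z powr (- q) * f z) = 0"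
    using zero by (simp_all add: crit_integral_def f_def deriv_P_poly)
  show ?thesis
  proof (rule ccontr)
    assume "p \<noteq> q"
    then consider "p < q" | "q < p" by linarith
    then show False
    proof cases
      case 1
      show False
        by (rule powr_moment_zero_unique[OF c c1 pos neg int int 1 zero']) (use pq in auto)
    next
      case 2
      show False
        by (rule powr_moment_zero_unique[OF c c1 pos neg int int 2 zero'(2,1)]) (use pq in auto)
    qed
  qed
qed

text \<open>
  A sign change on \<open>[a, b]\<close> yields a zero, which uniqueness identifies with the value of the
  definite description in \<open>p_crit\<close>. Existence of the critical exponent thus comes for free wherever
  it can be located.
\<close>

lemma p_crit_between:
  assumes r: "1 \<le> r" "r < n" and \<kappa>: "\<kappa> > 1"
    and ab: "0 < a" "a < b" "b < 1"
    and sign: "crit_integral n r \<kappa> a < 0" "crit_integral n r \<kappa> b > 0"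
  shows "a < p_crit n r \<kappa>" "p_crit n r \<kappa> < b"
proof -
  have eq: "crit_integral n r \<kappa> p = p * pole_sum n (crit_poly n r \<kappa>) p - 1" if "p < 1" for p
    by (rule crit_integral_eq) (use r that in auto)
  have "continuous_on {a..b} (\<lambda>p. p * pole_sum n (crit_poly n r \<kappa>) p - 1)"
    unfolding pole_sum_def using ab by (intro continuous_intros) auto
  then have "\<exists>p\<ge>a. p \<le> b \<and> p * pole_sum n (crit_poly n r \<kappa>) p - 1 = 0"
    using ab sign by (intro IVT') (auto simp: eq)
  then obtain p where p: "a \<le> p" "p \<le> b" "crit_integral n r \<kappa> p = 0"
    using ab eq by force
  have "p_crit n r \<kappa> = p"
    unfolding p_crit_def crit_integral_def[symmetric]
    using \<kappa> p ab r crit_integral_zero_unique[OF r \<kappa>] 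
    by (auto intro!: the_equality)
  moreover have "p \<noteq> a" "p \<noteq> b" using p sign by auto
  ultimately show "a < p_crit n r \<kappa>" "p_crit n r \<kappa> < b" using p by auto
qed

section \<open>The limit of the rescaled integral\<close>

lemma tendsto_coeff_power:
  fixes f :: "'a \<Rightarrow> real poly"
  assumes "\<And>k. ((\<lambda>x. coeff (f x) k) \<longlongrightarrow> coeff l k) F"
  shows "((\<lambda>x. coeff (f x ^ m) k) \<longlongrightarrow> coeff (l ^ m) k) F"
proof (induction m arbitrary: k)
  case (Suc m)
  then show ?case unfolding power_Suc coeff_mult by (intro tendsto_intros assms)
qed simp

text \<open>
  The value is the Beta integral \<open>\<integral>\<^sub>0\<^sup>1 z ^ (m - 1) * (1 - z) ^ r dz\<close>. Writing
  \<open>(1 - z) ^ (r + 1) = (1 - z) ^ r - z * (1 - z) ^ r\<close> reduces \<open>r + 1\<close> at \<open>m\<close> to \<open>r\<close> at \<open>m\<close> and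
  at \<open>m + 1\<close>, hence the induction on \<open>r\<close> for all \<open>m\<close> at once.
\<close>

lemma pole_sum_beta:
  assumes "m + r \<le> N" "1 \<le> m"
  shows "pole_sum N (monom 1 m * [:1, -1:] ^ r) 0 = fact (m - 1) * fact r / fact (m + r)"
  using assms
proof (induction r arbitrary: m)
  case 0
  have "pole_sum N (monom 1 m) 0 = (\<Sum>k=1..N. if k = m then 1 / real m else 0)"
    unfolding pole_sum_def by (intro sum.cong) (auto simp: coeff_monom)
  also have "\<dots> = 1 / real m" using 0 by simp
  finally show ?case using 0 by (simp add: fact_reduce[of m])
next
  case (Suc r)
  have split: "monom 1 m * [:1, -1 :: real:] ^ Suc r
      = monom 1 m * [:1, -1:] ^ r - monom 1 (Suc m) * [:1, -1:] ^ r"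
  proof -
    have "monom 1 m * [:1, -1 :: real:] = monom 1 m - monom 1 (Suc m)"
      by (simp add: monom_Suc)
    then show ?thesis by (metis (no_types, lifting) left_diff_distrib mult.assoc power_Suc)
  qed
  have "pole_sum N (monom 1 m * [:1, -1:] ^ Suc r) 0
     = pole_sum N (monom 1 m * [:1, -1:] ^ r) 0 - pole_sum N (monom 1 (Suc m) * [:1, -1:] ^ r) 0"
    unfolding split by (simp add: pole_sum_def diff_divide_distrib sum_subtractf)
  also have "\<dots> = fact (m - 1) * fact r / fact (m + r) - fact m * fact r / fact (Suc m + r)"
    using Suc.IH[of m] Suc.IH[of "Suc m"] Suc.prems by simp
  also have "\<dots> = fact (m - 1) * fact (Suc r) / fact (m + Suc r)"
    using Suc.prems by (cases m) (auto simp: divide_simps, simp add: algebra_simps)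
  finally show ?case .
qed

definition crit_const :: "nat \<Rightarrow> nat \<Rightarrow> real" where
  "crit_const n r = real (n choose r) * (real (n - r) ^ (n - r + 1) / real r ^ (n - r))"

lemma crit_const_pos: "1 \<le> r \<Longrightarrow> r < n \<Longrightarrow> crit_const n r > 0"
  by (simp add: crit_const_def)

text \<open>
  On the scale \<open>p = t / \<kappa> ^ (n - r)\<close> the prefactor \<open>p\<close> exactly cancels the growth
  \<open>\<kappa> ^ (n - r)\<close> of the coefficients, while \<open>p\<close> itself disappears from the denominators
  \<open>k - p\<close>. What survives is linear in \<open>t\<close>, with the Beta integral as slope.
\<close>

lemma rescaled_crit_integral_tendsto:
  assumes r: "1 \<le> r" "r < n"
  shows "((\<lambda>\<kappa>. crit_integral n r \<kappa> (t / \<kappa> ^ (n - r))) \<longlongrightarrow> t / crit_const n r - 1) at_top"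
proof -
  define m where "m = n - r"
  have m: "1 \<le> m" "m + r = n" using r by (auto simp: m_def)
  \<comment> \<open>\<open>R (1 / \<kappa>)\<close> is \<open>crit_poly n r \<kappa>\<close> divided by \<open>\<kappa> ^ m\<close>; in the variable \<open>u = 1 / \<kappa>\<close>
    the limit is the value at \<open>u = 0\<close>.\<close>
  define R where "R u = [:1, -1 :: real:] ^ r * [:u, real r / real m:] ^ m" for u
  have inv: "((\<lambda>\<kappa>::real. 1 / \<kappa>) \<longlongrightarrow> 0) at_top"
    by real_asymp
  have small: "((\<lambda>\<kappa>::real. t / \<kappa> ^ m) \<longlongrightarrow> 0) at_top"
    using m by (intro tendsto_divide_0[OF tendsto_const] filterlim_at_top_imp_at_infinity
        filterlim_pow_at_top filterlim_ident) auto
  have coeffs: "((\<lambda>\<kappa>. coeff (R (1 / \<kappa>)) k) \<longlongrightarrow> coeff (R 0) k) at_top" for k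
  proof -
    have "((\<lambda>\<kappa>. coeff [:1 / \<kappa>, real r / real m:] i) \<longlongrightarrow> coeff [:0, real r / real m:] i) at_top" for i
      by (cases i) (use inv in auto)
    then show ?thesis
      unfolding R_def coeff_mult by (intro tendsto_intros tendsto_coeff_power)
  qed
  have lim: "((\<lambda>\<kappa>. t * pole_sum n (R (1 / \<kappa>)) (t / \<kappa> ^ m) - 1) \<longlongrightarrow> t * pole_sum n (R 0) 0 - 1) at_top"
    unfolding pole_sum_def by (intro tendsto_intros coeffs small) auto
  have "R 0 = smult ((real r / real m) ^ m) (monom 1 m * [:1, -1:] ^ r)"
  proof -
    have "[:0, real r / real m:] ^ m = monom ((real r / real m) ^ m) m"
      by (metis monom_power monom_0 monom_Suc One_nat_def mult_1 pCons_0_0)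
    then show ?thesis
      by (simp add: R_def smult_monom mult.commute flip: mult_smult_left)
  qed
  then have "pole_sum n (R 0) 0
      = (real r / real m) ^ m * pole_sum n (monom 1 m * [:1, -1:] ^ r) 0"
    by (simp add: pole_sum_def sum_distrib_left)
  also have "\<dots> = (real r / real m) ^ m * (fact (m - 1) * fact r / fact n)"
    using pole_sum_beta[of m r n] m by simp
  also have "\<dots> = 1 / crit_const n r"
  proof -
    have "fact m = real m * fact (m - 1)" using m by (simp add: fact_reduce)
    moreover have "real (n choose r) = fact n / (fact r * fact m)"
      using r by (simp add: binomial_fact m_def)
    ultimately show ?thesis
      using r m unfolding crit_const_def m_def[symmetric]
      by (simp add: power_divide field_simps)
  qed
  finally have lim': "((\<lambda>\<kappa>. t * pole_sum n (R (1 / \<kappa>)) (t / \<kappa> ^ m) - 1)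
      \<longlongrightarrow> t / crit_const n r - 1) at_top"
    using lim by simp
  have "eventually (\<lambda>\<kappa>. t * pole_sum n (R (1 / \<kappa>)) (t / \<kappa> ^ m) - 1
      = crit_integral n r \<kappa> (t / \<kappa> ^ (n - r))) at_top"
    using eventually_gt_at_top[of 0] order_tendstoD(2)[OF small, of 1, OF zero_less_one]
  proof eventually_elim
    case (elim \<kappa>)
    have "[:1, \<kappa> * real r / real m:] = smult \<kappa> [:1 / \<kappa>, real r / real m:]"
      using elim by simp
    then have "crit_poly n r \<kappa> = smult (\<kappa> ^ m) (R (1 / \<kappa>))"
      by (simp add: crit_poly_def R_def m_def[symmetric] smult_power del: smult_pCons)
    then have "pole_sum n (crit_poly n r \<kappa>) p = \<kappa> ^ m * pole_sum n (R (1 / \<kappa>)) p" for p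
      by (simp add: pole_sum_def sum_distrib_left)
    then show ?case
      using crit_integral_eq[OF r, of "t / \<kappa> ^ m" \<kappa>] elim by (simp add: m_def)
  qed
  then show ?thesis using lim' by (rule Lim_transform_eventually[rotated])
qed

section \<open>Asymptotics of the critical exponent and of its minimum\<close>

text \<open>
  The limit function \<open>t / L - 1\<close> is negative for \<open>t < L\<close> and positive for \<open>t > L\<close>, so every pair
  \<open>0 < s < L < t\<close> eventually traps the rescaled critical exponent.
\<close>

lemma rescaled_p_crit_tendsto:
  assumes r: "1 \<le> r" "r < n"
  shows "((\<lambda>\<kappa>. p_crit n r \<kappa> * \<kappa> ^ (n - r)) \<longlongrightarrow> crit_const n r) at_top"
proof -
  define L where "L = crit_const n r"
  have L: "L > 0" using r by (simp add: L_def crit_const_pos)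
  have bracket: "eventually (\<lambda>\<kappa>. s < p_crit n r \<kappa> * \<kappa> ^ (n - r) \<and> p_crit n r \<kappa> * \<kappa> ^ (n - r) < t) at_top"
    if st: "0 < s" "s < L" "L < t" for s t
  proof -
    have "eventually (\<lambda>\<kappa>. crit_integral n r \<kappa> (s / \<kappa> ^ (n - r)) < 0) at_top"
      using st L by (intro order_tendstoD(2)[OF rescaled_crit_integral_tendsto[OF r]]) (simp add: L_def)
    moreover have "eventually (\<lambda>\<kappa>. crit_integral n r \<kappa> (t / \<kappa> ^ (n - r)) > 0) at_top"
      using st L by (intro order_tendstoD(1)[OF rescaled_crit_integral_tendsto[OF r]]) (simp add: L_def)
    moreover have "eventually (\<lambda>\<kappa>::real. t / \<kappa> ^ (n - r) < 1) at_top"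
      using r by (intro order_tendstoD(2)[of _ 0] tendsto_divide_0[OF tendsto_const]
        filterlim_at_top_imp_at_infinity filterlim_pow_at_top filterlim_ident) auto
    ultimately show ?thesis
      using eventually_gt_at_top[of 1]
    proof eventually_elim
      case (elim \<kappa>)
      have k: "\<kappa> ^ (n - r) > 0" using elim by simp
      have "0 < s / \<kappa> ^ (n - r)" "s / \<kappa> ^ (n - r) < t / \<kappa> ^ (n - r)"
        using k st by (auto simp: divide_strict_right_mono)
      from p_crit_between[OF r _ this] elim
      show ?case using k by (simp add: pos_divide_less_eq pos_less_divide_eq)
    qed
  qed
  show ?thesis
    unfolding L_def[symmetric]
  proof (rule order_tendstoI)
    fix a assume "a < L"
    \<comment> \<open>The lower end of a bracket has to be positive, so a possibly negative \<open>a\<close> is raised.\<close>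
    then show "eventually (\<lambda>\<kappa>. a < p_crit n r \<kappa> * \<kappa> ^ (n - r)) at_top"
      using bracket[of "max a (L / 2)" "L + 1"] L
      by (auto simp: less_max_iff_disj elim: eventually_mono)
  next
    fix a assume "L < a"
    then show "eventually (\<lambda>\<kappa>. p_crit n r \<kappa> * \<kappa> ^ (n - r) < a) at_top"
      using bracket[of "L / 2" a] L by (auto elim: eventually_mono)
  qed
qed

text \<open>
  On the common scale \<open>\<kappa> ^ (n - 1)\<close> the exponent for \<open>r = 1\<close> stays bounded, while for \<open>r \<ge> 2\<close> it
  is a quantity with a positive limit times \<open>\<kappa> ^ (r - 1)\<close> and tends to infinity.
\<close>

lemma p_low_eventually_eq:
  assumes n: "n \<ge> 2"
  shows "eventually (\<lambda>\<kappa>. p_low n \<kappa> = p_crit n 1 \<kappa>) at_top"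
proof -
  have "eventually (\<lambda>\<kappa>. \<forall>r\<in>{1..n - 1}. p_crit n 1 \<kappa> \<le> p_crit n r \<kappa>) at_top"
  proof (intro eventually_ball_finite ballI)
    fix r assume "r \<in> {1..n - 1}"
    then have r: "1 \<le> r" "r < n" using n by auto
    show "eventually (\<lambda>\<kappa>. p_crit n 1 \<kappa> \<le> p_crit n r \<kappa>) at_top"
    proof (cases "r = 1")
      case False
      have "filterlim (\<lambda>\<kappa>. p_crit n r \<kappa> * \<kappa> ^ (n - r) * \<kappa> ^ (r - 1)) at_top at_top"
        using r False
        by (intro filterlim_tendsto_pos_mult_at_top[OF rescaled_p_crit_tendsto crit_const_pos]
            filterlim_pow_at_top filterlim_ident) auto
      then have "eventually (\<lambda>\<kappa>. crit_const n 1 + 1 < p_crit n r \<kappa> * \<kappa> ^ (n - r) * \<kappa> ^ (r - 1)) at_top"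
        by (simp add: filterlim_at_top_dense)
      moreover have "eventually (\<lambda>\<kappa>. p_crit n 1 \<kappa> * \<kappa> ^ (n - 1) < crit_const n 1 + 1) at_top"
        using n by (intro order_tendstoD(2)[OF rescaled_p_crit_tendsto]) auto
      ultimately show ?thesis
        using eventually_gt_at_top[of 0]
      proof eventually_elim
        case (elim \<kappa>)
        have "\<kappa> ^ (n - 1) = \<kappa> ^ (n - r) * \<kappa> ^ (r - 1)"
          using r by (simp flip: power_add)
        then have "p_crit n r \<kappa> * \<kappa> ^ (n - r) * \<kappa> ^ (r - 1) = p_crit n r \<kappa> * \<kappa> ^ (n - 1)"
          by simp
        then have "p_crit n 1 \<kappa> * \<kappa> ^ (n - 1) < p_crit n r \<kappa> * \<kappa> ^ (n - 1)"
          using elim(1,2) by linarith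
        moreover have "\<kappa> ^ (n - 1) > 0" using elim by simp
        ultimately show ?case by (meson less_imp_le mult_right_less_imp_less)
      qed
    qed simp
  qed simp
  then show ?thesis
  proof eventually_elim
    case (elim \<kappa>)
    show ?case
      unfolding p_low_def using elim n by (intro Min_eqI) auto
  qed
qed

theorem proposition6p3:
  fixes n :: nat
  assumes "n \<ge> 2"
  shows "(\<forall>r\<in>{1..n - 1}.
            (\<lambda>\<kappa>. p_crit n r \<kappa>) \<sim>[at_top]
            (\<lambda>\<kappa>. real (n choose r) * (real (n - r) ^ (n - r + 1) / real r ^ (n - r))
                   * \<kappa> powi (- int (n - r))))
       \<and> (\<lambda>\<kappa>. p_low n \<kappa>) \<sim>[at_top]
            (\<lambda>\<kappa>. real n * real (n - 1) ^ n * \<kappa> powi (- int (n - 1)))"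
proof -
  have crit: "(\<lambda>\<kappa>. p_crit n r \<kappa>) \<sim>[at_top] (\<lambda>\<kappa>. crit_const n r * \<kappa> powi (- int (n - r)))"
    if r: "1 \<le> r" "r < n" for r
  proof (rule asymp_equivI')
    have pos: "crit_const n r > 0" using r by (rule crit_const_pos)
    have "((\<lambda>\<kappa>. p_crit n r \<kappa> * \<kappa> ^ (n - r) / crit_const n r) \<longlongrightarrow> 1) at_top"
      using tendsto_divide[OF rescaled_p_crit_tendsto[OF r] tendsto_const, of "crit_const n r"] pos
      by simp
    then show "((\<lambda>\<kappa>. p_crit n r \<kappa> / (crit_const n r * \<kappa> powi (- int (n - r)))) \<longlongrightarrow> 1) at_top"
      by (simp add: power_int_minus field_simps)
  qed
  have "crit_const n 1 = real n * real (n - 1) ^ n"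
    using assms by (simp add: crit_const_def)
  then have "(\<lambda>\<kappa>. p_crit n 1 \<kappa>) \<sim>[at_top] (\<lambda>\<kappa>. real n * real (n - 1) ^ n * \<kappa> powi (- int (n - 1)))"
    using crit[of 1] assms by simp
  then have low: "(\<lambda>\<kappa>. p_low n \<kappa>) \<sim>[at_top] (\<lambda>\<kappa>. real n * real (n - 1) ^ n * \<kappa> powi (- int (n - 1)))"
    using asymp_equiv_cong[OF p_low_eventually_eq[OF assms] always_eventually] by auto
  show ?thesis
    using crit low assms unfolding crit_const_def by auto
qed

end
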